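(* Let $\alpha\in\mathfrak S_a$ and $\beta\in\mathfrak S_b$ be permutations and let $\pi=12[\alpha,\beta]$. Then (i) $\operatorname{diam}(G_{\pi})=\operatorname{diam}(G_{\alpha})+\operatorname{diam}(G_{\beta})+\ell(\alpha)\ell(\beta)$; (ii) $\operatorname{diam}(C_{\pi})=\operatorname{diam}(C_{\alpha})+\operatorname{diam}(C_{\beta})$; (iii) $\operatorname{diam}(B_{\pi})=\operatorname{diam}(B_{\alpha})+\operatorname{diam}(B_{\beta})+\ell(\alpha)\ell(\beta)$.
   Context: For $\pi\in\mathfrak S_n$, $s_i=(i,i+1)$ denotes the adjacent transposition, $\ell(\pi)$ is the length of $\pi$ (its number of inversions), and $R(\pi)$ is the set of reduced words of $\pi$, i.e. words $r_1r_2\cdots r_{\ell(\pi)}$ with letters in $[n-1]$ such that $\pi=s_{r_1}s_{r_2}\cdots s_{r_{\ell(\pi)}}$. A commutation move exchanges two adjacent letters $jk$ with $|j-k|>1$; a long braid move replaces three consecutive letters $j(j+1)j$ by $(j+1)j(j+1)$ or vice versa. $G_\pi$ is the graph on vertex set $R(\pi)$ whose edges join words related by a single commutation move (commutation edges) or a single long braid move (long braid edges). $C_\pi$ is obtained from $G_\pi$ by contracting all commutation edges (vertices are commutation classes; two classes are adjacent if some members are related by a long braid move), and $B_\pi$ is obtained from $G_\pi$ by contracting all long braid edges (vertices are braid classes; adjacency via a commutation move). The diameter $\operatorname{diam}$ of a connected graph is the maximum distance between two vertices (a one-vertex graph has diameter $0$). For $\alpha=\alpha_1\cdots\alpha_a\in\mathfrak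 S_a$ and $\beta=\beta_1\cdots\beta_b\in\mathfrak S_b$ (sizes may be $0$), the inflation $12[\alpha,\beta]$ is the permutation $\alpha_1\cdots\alpha_a(\beta_1+a)\cdots(\beta_b+a)\in\mathfrak S_{a+b}$ in one-line notation. *)

theory Defs
  imports "HOL-Combinatorics.Permutations" "HOL-Library.Extended_Nat" "Graph_Theory.Pair_Digraph"
begin

section \<open>Permutations, length and reduced words\<close>

text \<open>
  An element of the symmetric group on \<open>[n]\<close> is a function \<open>p :: nat \<Rightarrow> nat\<close> with
  \<open>p permutes {1..n}\<close>; its one-line notation is \<open>p 1, \<dots>, p n\<close>.
\<close>

definition inversions :: "nat \<Rightarrow> (nat \<Rightarrow> nat) \<Rightarrow> (nat \<times> nat) set" where
  "inversions n p = {(i, j). 1 \<le> i \<and> i < j \<and> j \<le> n \<and> p j < p i}"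

definition perm_length :: "nat \<Rightarrow> (nat \<Rightarrow> nat) \<Rightarrow> nat" where
  "perm_length n p = card (inversions n p)"

definition adj_transp :: "nat \<Rightarrow> nat \<Rightarrow> nat" where
  "adj_transp i = transpose i (i + 1)"

text \<open>Products are composed as functions, so the rightmost letter acts first.\<close>

definition word_perm :: "nat list \<Rightarrow> nat \<Rightarrow> nat" where
  "word_perm w = foldr (\<lambda>r p. adj_transp r \<circ> p) w id"

definition reduced_words :: "nat \<Rightarrow> (nat \<Rightarrow> nat) \<Rightarrow> nat list set" where
  "reduced_words n p =
     {w. set w \<subseteq> {1..n - 1} \<and> length w = perm_length n p \<and> word_perm w = p}"

definition inflation12 :: "nat \<Rightarrow> nat \<Rightarrow> (nat \<Rightarrow> nat) \<Rightarrow> (nat \<Rightarrow> nat) \<Rightarrow> nat \<Rightarrow> nat" where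
  "inflation12 a b \<alpha> \<beta> i =
     (if 1 \<le> i \<and> i \<le> a then \<alpha> i
      else if a < i \<and> i \<le> a + b then \<beta> (i - a) + a
      else i)"

lemma inflation12_one_line:
  "map (inflation12 a b \<alpha> \<beta>) [1..<a + b + 1] =
     map \<alpha> [1..<a + 1] @ map (\<lambda>i. \<beta> i + a) [1..<b + 1]"
  by (rule nth_equalityI) (auto simp: inflation12_def nth_append Suc_diff_le simp del: upt_Suc)

lemma inflation12_permutes:
  assumes "\<alpha> permutes {1..a}" and "\<beta> permutes {1..b}"
  shows "inflation12 a b \<alpha> \<beta> permutes {1..a + b}"
proof (rule bij_imp_permutes)
  have \<alpha>: "\<alpha> i \<in> {1..a} \<longleftrightarrow> i \<in> {1..a}" for i
    using permutes_in_image[OF assms(1)] .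
  have \<beta>: "\<beta> i \<in> {1..b} \<longleftrightarrow> i \<in> {1..b}" for i
    using permutes_in_image[OF assms(2)] .
  let ?f = "inflation12 a b \<alpha> \<beta>"
  have "inj_on ?f {1..a + b}"
  proof (rule inj_onI)
    fix i j assume i: "i \<in> {1..a + b}" and j: "j \<in> {1..a + b}" and eq: "?f i = ?f j"
    have \<alpha>_le: "\<alpha> i \<le> a" if "i \<in> {1..a}" for i using \<alpha>[of i] that by auto
    have \<beta>_ge: "1 \<le> \<beta> (i - a)" if "i \<in> {a<..a + b}" for i using \<beta>[of "i - a"] that by auto
    have lo: "?f i = \<alpha> i" if "i \<in> {1..a}" for i using that by (simp add: inflation12_def)
    have hi: "?f i = \<beta> (i - a) + a" if "i \<in> {a<..a + b}" for i
      using that by (simp add: inflation12_def)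
    consider "i \<in> {1..a}" "j \<in> {1..a}" | "i \<in> {a<..a + b}" "j \<in> {a<..a + b}"
      | "i \<in> {1..a}" "j \<in> {a<..a + b}" | "i \<in> {a<..a + b}" "j \<in> {1..a}"
      using i j by force
    then show "i = j"
    proof cases
      case 1
      then show ?thesis using eq lo injD[OF permutes_inj[OF assms(1)], of i j] by simp
    next
      case 2
      then have "\<beta> (i - a) = \<beta> (j - a)" using eq hi by simp
      then have "i - a = j - a" using injD[OF permutes_inj[OF assms(2)]] by blast
      then show ?thesis using 2 by auto
    next
      case 3
      then show ?thesis using eq lo[of i] hi[of j] \<alpha>_le[of i] \<beta>_ge[of j] by linarith
    next
      case 4
      then show ?thesis using eq lo[of j] hi[of i] \<alpha>_le[of j] \<beta>_ge[of i] by linarith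
    qed
  qed
  moreover have "?f ` {1..a + b} \<subseteq> {1..a + b}"
  proof
    fix k assume "k \<in> ?f ` {1..a + b}"
    then obtain i where "i \<in> {1..a + b}" "k = ?f i" by blast
    then show "k \<in> {1..a + b}"
      using \<alpha>[of i] \<beta>[of "i - a"] by (cases "i \<le> a") (auto simp: inflation12_def)
  qed
  ultimately show "bij_betw ?f {1..a + b} {1..a + b}"
    by (simp add: bij_betw_def endo_inj_surj)
qed (auto simp: inflation12_def)

section \<open>Commutation and long braid moves\<close>

definition commutation_move :: "nat list \<Rightarrow> nat list \<Rightarrow> bool" where
  "commutation_move v w \<longleftrightarrow>
     (\<exists>xs ys j k. \<bar>int j - int k\<bar> > 1 \<and> v = xs @ [j, k] @ ys \<and> w = xs @ [k, j] @ ys)"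

definition long_braid_move :: "nat list \<Rightarrow> nat list \<Rightarrow> bool" where
  "long_braid_move v w \<longleftrightarrow>
     (\<exists>xs ys j.
        v = xs @ [j, j + 1, j] @ ys \<and> w = xs @ [j + 1, j, j + 1] @ ys \<or>
        v = xs @ [j + 1, j, j + 1] @ ys \<and> w = xs @ [j, j + 1, j] @ ys)"

section \<open>Graphs\<close>

text \<open>
  Undirected graphs are symmetric digraphs without parallel arcs: each edge is
  represented by its two orientations.
\<close>

definition commutation_edges :: "nat \<Rightarrow> (nat \<Rightarrow> nat) \<Rightarrow> nat list rel" where
  "commutation_edges n p =
     {(v, w). v \<in> reduced_words n p \<and> w \<in> reduced_words n p \<and> commutation_move v w}"

definition long_braid_edges :: "nat \<Rightarrow> (nat \<Rightarrow> nat) \<Rightarrow> nat list rel" where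
  "long_braid_edges n p =
     {(v, w). v \<in> reduced_words n p \<and> w \<in> reduced_words n p \<and> long_braid_move v w}"

definition G_graph :: "nat \<Rightarrow> (nat \<Rightarrow> nat) \<Rightarrow> nat list pair_pre_digraph" where
  "G_graph n p =
     \<lparr> pverts = reduced_words n p, parcs = commutation_edges n p \<union> long_braid_edges n p \<rparr>"

text \<open>
  Contraction of a symmetric set \<open>E\<close> of edges of \<open>G\<close>. The vertices of the result are the
  connected components of the spanning subgraph of \<open>G\<close> with edge set \<open>E\<close>; loops are discarded.
\<close>

definition contract_edges :: "'a pair_pre_digraph \<Rightarrow> 'a rel \<Rightarrow> 'a set pair_pre_digraph" where
  "contract_edges G E =
     \<lparr> pverts = pverts G // E\<^sup>*,
       parcs = {(X, Y). X \<in> pverts G // E\<^sup>* \<and> Y \<in> pverts G // E\<^sup>* \<and> X \<noteq> Y \<and>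
                        (\<exists>x\<in>X. \<exists>y\<in>Y. (x, y) \<in> parcs G - E)} \<rparr>"

definition C_graph :: "nat \<Rightarrow> (nat \<Rightarrow> nat) \<Rightarrow> nat list set pair_pre_digraph" where
  "C_graph n p = contract_edges (G_graph n p) (commutation_edges n p)"

definition B_graph :: "nat \<Rightarrow> (nat \<Rightarrow> nat) \<Rightarrow> nat list set pair_pre_digraph" where
  "B_graph n p = contract_edges (G_graph n p) (long_braid_edges n p)"

text \<open>Distances between vertices in different components are \<open>\<infinity>\<close>.\<close>

definition graph_dist :: "'a pair_pre_digraph \<Rightarrow> 'a \<Rightarrow> 'a \<Rightarrow> enat" where
  "graph_dist G u v = (INF p \<in> {p. pre_digraph.awalk (with_proj G) u p v}. enat (length p))"

definition diam :: "'a pair_pre_digraph \<Rightarrow> enat" where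
  "diam G = (SUP u \<in> pverts G. SUP v \<in> pverts G. graph_dist G u v)"

end

theory Submission
  imports Defs
begin

text \<open>
  Give each commutation move weight \<open>c\<close> and each long braid move weight \<open>d\<close>. Contracting edges
  amounts to giving them weight \<open>0\<close>, so the three diameters are weighted diameters of \<open>R(\<pi>)\<close> with
  \<open>(c, d) = (1, 1), (0, 1), (1, 0)\<close>. The reduced words of \<open>12[\<alpha>, \<beta>]\<close> are the shuffles of a reduced
  word of \<open>\<alpha>\<close> with a shifted reduced word of \<open>\<beta>\<close>. Every move in a shuffle is a move of one of
  the two factors or a commutation of a letter of \<open>\<alpha>\<close> with a letter of \<open>\<beta>\<close>; the latter changes the
  number of pairs in which a \<open>\<beta>\<close>-letter precedes an \<open>\<alpha>\<close>-letter by one. This number runs from \<open>0\<close> to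
  \<open>\<ell>(\<alpha>) \<ell>(\<beta>)\<close>, which gives the lower bound. For the upper bound, one travels through one of the two
  extreme shuffles, where the factors can be transformed independently.
  Distances are extended naturals, so connectedness of the graphs is never needed.
\<close>

section \<open>Weighted paths\<close>

text \<open>The cost is an argument of the step relation, so one pair may be joined by steps of
  different cost, and steps of cost 0 are allowed.\<close>

inductive wpath :: "('a \<Rightarrow> nat \<Rightarrow> 'a \<Rightarrow> bool) \<Rightarrow> 'a \<Rightarrow> nat \<Rightarrow> 'a \<Rightarrow> bool" for W where
  refl: "wpath W u 0 u"
| step: "wpath W u k v \<Longrightarrow> W v l w \<Longrightarrow> wpath W u (k + l) w"

lemma wpath_edge: "W u k v \<Longrightarrow> wpath W u k v"
  using wpath.step[OF wpath.refl, of W u k v] by simp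

lemma wpath_trans:
  assumes "wpath W v l w" and "wpath W u k v"
  shows "wpath W u (k + l) w"
  using assms
proof (induction rule: wpath.induct)
  case (step v l w l' x)
  then show ?case using wpath.step[of W u "k + l" w l' x] by (simp add: add.assoc)
qed simp

lemma wpath_sym:
  assumes "wpath W u k v" and "\<And>x l y. W x l y \<Longrightarrow> W y l x"
  shows "wpath W v k u"
  using assms(1)
proof (induction rule: wpath.induct)
  case (step u k v l w)
  then show ?case using wpath_trans[OF step.IH wpath_edge[of W w l v]] assms(2)
    by (simp add: add.commute)
qed (rule wpath.refl)

lemma wpath_map:
  assumes "wpath W u k v" and "\<And>x l y. W x l y \<Longrightarrow> W' (f x) l (f y)"
  shows "wpath W' (f u) k (f v)"
  using assms(1)
proof (induction rule: wpath.induct)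
  case (step u k v l w)
  then show ?case using wpath.step[of W' "f u" k "f v" l "f w"] assms(2) by simp
qed (rule wpath.refl)

text \<open>Graph arcs are confined to reduced words whereas moves are defined on all words. A set
  closed under steps makes the two kinds of path interchangeable.\<close>

lemma wpath_restrict:
  assumes "wpath W u k v" and "u \<in> S"
    and "\<And>x l y. x \<in> S \<Longrightarrow> W x l y \<Longrightarrow> y \<in> S \<and> W' x l y"
  shows "v \<in> S \<and> wpath W' u k v"
  using assms(1,2)
proof (induction rule: wpath.induct)
  case (step u k v l w)
  then show ?case using wpath.step[of W' u k v l w] assms(3) by blast
qed (simp add: wpath.refl)

text \<open>The infimum of the empty set is infinity, so unreachable pairs are treated as in
  \<open>graph_dist\<close>.\<close>

definition wdist :: "('a \<Rightarrow> nat \<Rightarrow> 'a \<Rightarrow> bool) \<Rightarrow> 'a \<Rightarrow> 'a \<Rightarrow> enat" where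
  "wdist W u v = (INF k \<in> {k. wpath W u k v}. enat k)"

definition wdiam :: "('a \<Rightarrow> nat \<Rightarrow> 'a \<Rightarrow> bool) \<Rightarrow> 'a set \<Rightarrow> enat" where
  "wdiam W S = (SUP (u, v) \<in> S \<times> S. wdist W u v)"

lemma wdist_le: "wpath W u k v \<Longrightarrow> wdist W u v \<le> enat k"
  unfolding wdist_def by (rule INF_lower2) auto

lemma wdist_greatest: "(\<And>k. wpath W u k v \<Longrightarrow> z \<le> enat k) \<Longrightarrow> z \<le> wdist W u v"
  unfolding wdist_def by (rule INF_greatest) auto

text \<open>A finite infimum of naturals is a minimum.\<close>

lemma wdist_attained:
  assumes "wdist W u v \<noteq> \<infinity>"
  obtains k where "wpath W u k v" and "wdist W u v = enat k"
proof -
  let ?A = "enat ` {k. wpath W u k v}"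
  have "?A \<noteq> {}"
    using assms unfolding wdist_def by (metis Inf_empty top_enat_def)
  then have "Inf ?A \<in> ?A"
    unfolding Inf_enat_def by (auto intro: LeastI)
  then show thesis using that by (auto simp: wdist_def)
qed

lemma wdist_le_wdiam: "u \<in> S \<Longrightarrow> v \<in> S \<Longrightarrow> wdist W u v \<le> wdiam W S"
  unfolding wdiam_def by (rule SUP_upper2[of "(u, v)"]) auto

lemma wdiam_cong:
  assumes "\<And>u k v. u \<in> S \<Longrightarrow> v \<in> S \<Longrightarrow> wpath W u k v \<longleftrightarrow> wpath W' u k v"
  shows "wdiam W S = wdiam W' S"
  unfolding wdiam_def wdist_def using assms by (intro SUP_cong) auto

text \<open>If \<open>d\<close> is finite, then \<open>z\<close> is finite and can be subtracted
  from the bound. An empty supremum is 0, and \<open>z\<close> alone might exceed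
  \<open>d\<close>.\<close>

lemma enat_SUP_add_le:
  fixes f :: "'a \<Rightarrow> enat"
  assumes "A \<noteq> {}" and "\<And>x. x \<in> A \<Longrightarrow> f x + z \<le> d"
  shows "(SUP x\<in>A. f x) + z \<le> d"
proof (cases d)
  case (enat m)
  obtain x0 where "x0 \<in> A" using assms(1) by blast
  then have "f x0 + z \<le> enat m" using assms(2) enat by blast
  then obtain j where z: "z = enat j" and "j \<le> m"
    by (cases z; cases "f x0") auto
  have "f x \<le> enat (m - j)" if "x \<in> A" for x
    using assms(2)[OF that] enat z by (cases "f x") auto
  then have "(SUP x\<in>A. f x) \<le> enat (m - j)" by (rule SUP_least)
  then have "(SUP x\<in>A. f x) + z \<le> enat (m - j) + z" by (rule add_right_mono)
  then show ?thesis using z enat \<open>j \<le> m\<close> by simp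
qed simp

section \<open>Diameters of contracted graphs\<close>

lemma awalk_iff_relpow:
  "(\<exists>es. pre_digraph.awalk (with_proj G) u es v \<and> length es = k) \<longleftrightarrow>
     u \<in> pverts G \<and> (u, v) \<in> parcs G ^^ k"
proof -
  have "(\<exists>es. set es \<subseteq> parcs G \<and> pre_digraph.cas (with_proj G) u es v \<and> length es = k) \<longleftrightarrow>
     (u, v) \<in> parcs G ^^ k"
  proof (induction k arbitrary: u)
    case 0
    show ?case by (simp add: pre_digraph.cas.simps)
  next
    case (Suc k)
    have "(\<exists>es. set es \<subseteq> parcs G \<and> pre_digraph.cas (with_proj G) u es v \<and> length es = Suc k)
      \<longleftrightarrow> (\<exists>x es. (u, x) \<in> parcs G \<and> set es \<subseteq> parcs G \<and>
            pre_digraph.cas (with_proj G) x es v \<and> length es = k)"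
      (is "?L \<longleftrightarrow> ?R")
    proof
      assume ?L
      then obtain e es where "e \<in> parcs G" "set es \<subseteq> parcs G" "length es = k"
          "pre_digraph.cas (with_proj G) u (e # es) v"
        by (auto simp: length_Suc_conv)
      then show ?R
        by (intro exI[of _ "snd e"] exI[of _ es]) (auto simp: pre_digraph.cas.simps)
    next
      assume ?R
      then obtain x es where "(u, x) \<in> parcs G" "set es \<subseteq> parcs G"
          "pre_digraph.cas (with_proj G) x es v" "length es = k"
        by blast
      then show ?L
        by (intro exI[of _ "(u, x) # es"]) (auto simp: pre_digraph.cas.simps)
    qed
    also have "\<dots> \<longleftrightarrow> (\<exists>x. (u, x) \<in> parcs G \<and> (x, v) \<in> parcs G ^^ k)"
      unfolding Suc.IH[symmetric] by blast
    \<comment> \<open>\<open>cas\<close> peels arcs off the front, whereas relational powers unfold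
      at the end.\<close>
    also have "\<dots> \<longleftrightarrow> (u, v) \<in> parcs G ^^ Suc k"
      using relpow_Suc_I2 relpow_Suc_D2 by metis
    finally show ?case .
  qed
  then show ?thesis by (auto simp: pre_digraph.awalk_def)
qed

definition unit_cost :: "'a rel \<Rightarrow> 'a \<Rightarrow> nat \<Rightarrow> 'a \<Rightarrow> bool" where
  "unit_cost R x k y \<longleftrightarrow> (x, y) \<in> R \<and> k = 1"

lemma relpow_iff_wpath: "(u, v) \<in> R ^^ k \<longleftrightarrow> wpath (unit_cost R) u k v"
proof
  show "(u, v) \<in> R ^^ k \<Longrightarrow> wpath (unit_cost R) u k v"
  proof (induction k arbitrary: v)
    case (Suc k)
    then obtain x where "(u, x) \<in> R ^^ k" "(x, v) \<in> R" by auto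
    moreover from this have "unit_cost R x 1 v" by (simp add: unit_cost_def)
    ultimately show ?case using Suc.IH wpath.step[of "unit_cost R" u k x 1 v] by simp
  qed (simp add: wpath.refl)
  show "wpath (unit_cost R) u k v \<Longrightarrow> (u, v) \<in> R ^^ k"
    by (induction rule: wpath.induct) (auto simp: unit_cost_def)
qed

lemma graph_dist_eq_wdist:
  assumes "u \<in> pverts G"
  shows "graph_dist G u v = wdist (unit_cost (parcs G)) u v"
proof -
  have "length ` {es. pre_digraph.awalk (with_proj G) u es v} = {k. wpath (unit_cost (parcs G)) u k v}"
  proof (rule set_eqI)
    fix k
    show "k \<in> length ` {es. pre_digraph.awalk (with_proj G) u es v} \<longleftrightarrow>
        k \<in> {k. wpath (unit_cost (parcs G)) u k v}"
      using awalk_iff_relpow[of G u v k] assms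
      by (simp add: relpow_iff_wpath image_iff eq_commute[of k "length _"])
  qed
  then show ?thesis
    unfolding graph_dist_def wdist_def by (metis image_image)
qed

lemma diam_eq_wdiam: "diam G = wdiam (unit_cost (parcs G)) (pverts G)"
proof -
  have "diam G = (SUP u \<in> pverts G. SUP v \<in> pverts G. wdist (unit_cost (parcs G)) u v)"
    unfolding diam_def by (simp add: graph_dist_eq_wdist cong: SUP_cong)
  also have "\<dots> = wdiam (unit_cost (parcs G)) (pverts G)"
    unfolding wdiam_def
    by (intro antisym SUP_least) (auto intro: SUP_upper2 SUP_upper2[of "(_, _)"])
  finally show ?thesis .
qed

definition contract_cost :: "'a rel \<Rightarrow> 'a rel \<Rightarrow> 'a \<Rightarrow> nat \<Rightarrow> 'a \<Rightarrow> bool" where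
  "contract_cost E F x k y \<longleftrightarrow> (x, y) \<in> E \<and> k = 0 \<or> (x, y) \<in> F \<and> k = 1"

lemma wpath_rtrancl: "(u, v) \<in> E\<^sup>* \<Longrightarrow> wpath (contract_cost E F) u 0 v"
proof (induction rule: rtrancl_induct)
  case (step y z)
  then show ?case using wpath.step[of _ u 0 y 0 z] by (simp add: contract_cost_def)
qed (rule wpath.refl)

text \<open>A path projects to a walk of classes in which \<open>E\<close>-steps stand still.
  Conversely, a walk of classes lifts by joining representatives inside each class at cost
  0.\<close>

lemma wdist_contract_edges:
  fixes G :: "'a pair_pre_digraph"
  assumes "sym E" and wf: "parcs G \<subseteq> pverts G \<times> pverts G" and "E \<subseteq> parcs G"
    and u: "u \<in> pverts G"
  shows "wdist (unit_cost (parcs (contract_edges G E))) (E\<^sup>* `` {u}) (E\<^sup>* `` {v}) =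
     wdist (contract_cost E (parcs G - E)) u v"
    (is "wdist ?U _ _ = wdist ?W u v")
proof (rule antisym)
  have symE: "sym (E\<^sup>*)" using \<open>sym E\<close> by (rule sym_rtrancl)
  have cls: "E\<^sup>* `` {x} = E\<^sup>* `` {y}" if "(x, y) \<in> E\<^sup>*" for x y
    using that symD[OF symE that] by (auto intro: rtrancl_trans)
  \<comment> \<open>Only an inequality: a costly step inside one class becomes a discarded
    loop.\<close>
  have low: "\<exists>k'\<le>k. wpath ?U (E\<^sup>* `` {u}) k' (E\<^sup>* `` {v})" if "wpath ?W u k v" for k v
    using that u
  proof (induction rule: wpath.induct)
    case (refl u)
    then show ?case by (intro exI[of _ 0]) (simp add: wpath.refl)
  next
    case (step u k v l w)
    then obtain k' where k': "k' \<le> k" "wpath ?U (E\<^sup>* `` {u}) k' (E\<^sup>* `` {v})" by blast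
    from step(2) consider "(v, w) \<in> E" | "(v, w) \<in> parcs G - E" "l = 1"
      by (auto simp: contract_cost_def)
    then show ?case
    proof cases
      case 1
      then have "E\<^sup>* `` {v} = E\<^sup>* `` {w}" by (intro cls) auto
      then show ?thesis using k' by (intro exI[of _ k']) auto
    next
      case 2
      show ?thesis
      proof (cases "E\<^sup>* `` {v} = E\<^sup>* `` {w}")
        case True
        then show ?thesis using k' by (intro exI[of _ k']) auto
      next
        case False
        have "v \<in> pverts G" "w \<in> pverts G" using 2 wf by auto
        moreover have "v \<in> E\<^sup>* `` {v}" "w \<in> E\<^sup>* `` {w}" by auto
        ultimately have "(E\<^sup>* `` {v}, E\<^sup>* `` {w}) \<in> parcs (contract_edges G E)"
          using False 2 unfolding contract_edges_def by (auto simp: quotientI)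
        then have "wpath ?U (E\<^sup>* `` {u}) (k' + 1) (E\<^sup>* `` {w})"
          using wpath.step[OF k'(2), of 1] by (simp add: unit_cost_def)
        then show ?thesis using k'(1) 2(2) by (intro exI[of _ "k' + 1"]) auto
      qed
    qed
  qed
  show "wdist ?U (E\<^sup>* `` {u}) (E\<^sup>* `` {v}) \<le> wdist ?W u v"
    by (rule wdist_greatest) (use low wdist_le order_trans enat_ord_simps(1) in metis)
  have class_rel: "(x, y) \<in> E\<^sup>*" if "X \<in> pverts G // E\<^sup>*" "x \<in> X" "y \<in> X" for X x y
    using that symE by (auto simp: quotient_def sym_def intro: rtrancl_trans)
  \<comment> \<open>Arbitrary representatives are needed, since the induction hypothesis is applied
    to the end of an arc between the classes.\<close>
  have up: "wpath ?W x k y" if "wpath ?U X k Y" "x \<in> X" "y \<in> Y" "X \<in> pverts G // E\<^sup>*"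
    for X k Y x y
    using that
  proof (induction arbitrary: y rule: wpath.induct)
    case (refl X)
    then show ?case by (intro wpath_rtrancl class_rel)
  next
    case (step X k Y l Z)
    then obtain y' z where yz: "y' \<in> Y" "z \<in> Z" "(y', z) \<in> parcs G - E" and l: "l = 1"
      and Z: "Z \<in> pverts G // E\<^sup>*"
      by (auto simp: unit_cost_def contract_edges_def)
    have "?W y' 1 z" using yz(3) by (simp add: contract_cost_def)
    with step.IH[OF step.prems(1) yz(1) step.prems(3)] have "wpath ?W x (k + 1) z"
      by (rule wpath.step)
    moreover have "wpath ?W z 0 y"
      using class_rel[OF Z yz(2) step.prems(2)] by (rule wpath_rtrancl)
    ultimately have "wpath ?W x (k + 1 + 0) y" by (rule wpath_trans[rotated])
    then show ?case using l by simp
  qed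
  show "wdist ?W u v \<le> wdist ?U (E\<^sup>* `` {u}) (E\<^sup>* `` {v})"
    by (rule wdist_greatest, rule wdist_le, rule up) (auto simp: u quotientI)
qed

lemma diam_contract_edges:
  assumes "sym E" and "parcs G \<subseteq> pverts G \<times> pverts G" and "E \<subseteq> parcs G"
  shows "diam (contract_edges G E) = wdiam (contract_cost E (parcs G - E)) (pverts G)"
proof -
  let ?q = "\<lambda>x. E\<^sup>* `` {x}"
  have verts: "pverts (contract_edges G E) = ?q ` pverts G"
    by (auto simp: contract_edges_def quotient_def)
  have "diam (contract_edges G E) =
     (SUP (u, v) \<in> pverts G \<times> pverts G.
        wdist (unit_cost (parcs (contract_edges G E))) (?q u) (?q v))"
    unfolding diam_eq_wdiam wdiam_def verts
    by (simp add: image_paired_Times[symmetric] image_image case_prod_unfold)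
  also have "\<dots> = wdiam (contract_cost E (parcs G - E)) (pverts G)"
    unfolding wdiam_def using wdist_contract_edges[OF assms] by (intro SUP_cong) auto
  finally show ?thesis .
qed

section \<open>Moves on words\<close>

text \<open>The two parameters let one relation serve all three graphs.\<close>

definition move_cost :: "nat \<Rightarrow> nat \<Rightarrow> nat list \<Rightarrow> nat \<Rightarrow> nat list \<Rightarrow> bool" where
  "move_cost c d v k w \<longleftrightarrow> commutation_move v w \<and> k = c \<or> long_braid_move v w \<and> k = d"

lemma commutation_move_sym: "commutation_move v w \<Longrightarrow> commutation_move w v"
  unfolding commutation_move_def by (metis abs_minus_commute)

lemma long_braid_move_sym: "long_braid_move v w \<Longrightarrow> long_braid_move w v"
  unfolding long_braid_move_def by blast

lemma move_cost_sym: "move_cost c d v k w \<Longrightarrow> move_cost c d w k v"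
  unfolding move_cost_def using commutation_move_sym long_braid_move_sym by blast

text \<open>The braid case merges both orientations of a long braid move into one pattern.\<close>

lemma move_cost_cases [consumes 1, case_names commutation braid]:
  assumes "move_cost c d v k w"
  obtains xs ys i j where "\<bar>int i - int j\<bar> > 1" "k = c"
      "v = xs @ [i, j] @ ys" "w = xs @ [j, i] @ ys"
  | xs ys i j where "j = i + 1 \<or> i = j + 1" "k = d"
      "v = xs @ [i, j, i] @ ys" "w = xs @ [j, i, j] @ ys"
  using assms unfolding move_cost_def commutation_move_def long_braid_move_def by blast

lemma move_cost_commutation:
  "\<bar>int i - int j\<bar> > 1 \<Longrightarrow> move_cost c d (xs @ [i, j] @ ys) c (xs @ [j, i] @ ys)"
  unfolding move_cost_def commutation_move_def by blast

lemma move_cost_braid: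
  "j = i + 1 \<or> i = j + 1 \<Longrightarrow> move_cost c d (xs @ [i, j, i] @ ys) d (xs @ [j, i, j] @ ys)"
  unfolding move_cost_def long_braid_move_def by blast

lemma move_cost_append:
  assumes "move_cost c d v k w"
  shows "move_cost c d (xs @ v @ ys) k (xs @ w @ ys)"
  using assms
proof (cases rule: move_cost_cases)
  case (commutation us vs i j)
  then show ?thesis using move_cost_commutation[of i j c d "xs @ us" "vs @ ys"] by simp
next
  case (braid us vs i j)
  then show ?thesis using move_cost_braid[of j i c d "xs @ us" "vs @ ys"] by simp
qed

lemma move_cost_map:
  assumes "move_cost c d v k w"
    and "\<And>i j. i \<in> set v \<Longrightarrow> j \<in> set v \<Longrightarrow> int (f i) - int (f j) = int i - int j"
  shows "move_cost c d (map f v) k (map f w)"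
  using assms(1)
proof (cases rule: move_cost_cases)
  case (commutation us vs i j)
  then have "\<bar>int (f i) - int (f j)\<bar> > 1" using assms(2)[of i j] by simp
  then show ?thesis
    using commutation move_cost_commutation[of "f i" "f j" c d "map f us" "map f vs"] by simp
next
  case (braid us vs i j)
  then have "int (f i) - int (f j) = int i - int j" using assms(2) by simp
  then have "f j = f i + 1 \<or> f i = f j + 1" using braid(1) by linarith
  then show ?thesis using braid move_cost_braid[of "f j" "f i" c d "map f us" "map f vs"] by simp
qed

lemma move_cost_set: "move_cost c d v k w \<Longrightarrow> set w = set v"
  by (erule move_cost_cases) auto

lemma move_cost_length: "move_cost c d v k w \<Longrightarrow> length w = length v"
  by (erule move_cost_cases) auto

text \<open>Commutations preserve the multiset of letters, long braid moves do not. Hence removing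
  the contracted edges from the arcs removes no edge of the other kind.\<close>

lemma not_commutation_and_long_braid:
  assumes "commutation_move v w" and "long_braid_move v w"
  shows False
proof -
  have "mset v = mset w" using assms(1) by (auto simp: commutation_move_def)
  then show False using assms(2) by (auto simp: long_braid_move_def)
qed

section \<open>Moves and the permutation of a word\<close>

lemma word_perm_Nil [simp]: "word_perm [] = id"
  by (simp add: word_perm_def)

lemma word_perm_Cons [simp]: "word_perm (r # w) = adj_transp r \<circ> word_perm w"
  by (simp add: word_perm_def)

lemma word_perm_append [simp]: "word_perm (v @ w) = word_perm v \<circ> word_perm w"
  by (induction v) (auto simp: comp_assoc)

lemma move_cost_word_perm:
  assumes "move_cost c d v k w"
  shows "word_perm w = word_perm v"
  using assms
proof (cases rule: move_cost_cases)
  case (commutation xs ys i j)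
  then have "word_perm [j, i] = word_perm [i, j]"
    by (auto simp: fun_eq_iff adj_transp_def transpose_def)
  then show ?thesis unfolding commutation word_perm_append by simp
next
  case (braid xs ys i j)
  then have "word_perm [j, i, j] = word_perm [i, j, i]"
    by (auto simp: fun_eq_iff adj_transp_def transpose_def)
  then show ?thesis unfolding braid word_perm_append by simp
qed

lemma move_cost_reduced_words:
  "move_cost c d v k w \<Longrightarrow> v \<in> reduced_words n p \<Longrightarrow> w \<in> reduced_words n p"
  using move_cost_set move_cost_length move_cost_word_perm by (auto simp: reduced_words_def)

text \<open>Moves never leave the set of reduced words, so agreement of the steps that start there
  suffices.\<close>

lemma wdiam_move_cost:
  assumes "\<And>v k w. v \<in> reduced_words n p \<Longrightarrow> W v k w \<longleftrightarrow> w \<in> reduced_words n p \<and> move_cost c d v k w"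
  shows "wdiam W (reduced_words n p) = wdiam (move_cost c d) (reduced_words n p)"
proof (rule wdiam_cong)
  fix u k v assume "u \<in> reduced_words n p"
  then show "wpath W u k v \<longleftrightarrow> wpath (move_cost c d) u k v"
    using wpath_restrict[of W u k v "reduced_words n p" "move_cost c d"]
      wpath_restrict[of "move_cost c d" u k v "reduced_words n p" W]
      assms move_cost_reduced_words by blast
qed

section \<open>The three graph diameters as weighted diameters\<close>

lemma G_graph_wf: "parcs (G_graph n p) \<subseteq> pverts (G_graph n p) \<times> pverts (G_graph n p)"
  by (auto simp: G_graph_def commutation_edges_def long_braid_edges_def)

lemma diam_G_graph: "diam (G_graph n p) = wdiam (move_cost 1 1) (reduced_words n p)"
  unfolding diam_eq_wdiam
  by (simp add: G_graph_def, rule wdiam_move_cost)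
     (auto simp: unit_cost_def move_cost_def commutation_edges_def long_braid_edges_def)

lemma diam_C_graph: "diam (C_graph n p) = wdiam (move_cost 0 1) (reduced_words n p)"
proof -
  have "diam (C_graph n p) = wdiam (contract_cost (commutation_edges n p)
      (parcs (G_graph n p) - commutation_edges n p)) (pverts (G_graph n p))"
    unfolding C_graph_def
    by (rule diam_contract_edges[OF _ G_graph_wf])
       (auto simp: G_graph_def commutation_edges_def sym_def commutation_move_sym)
  also have "\<dots> = wdiam (move_cost 0 1) (reduced_words n p)"
    by (simp add: G_graph_def, rule wdiam_move_cost)
       (auto simp: contract_cost_def move_cost_def commutation_edges_def long_braid_edges_def
          dest: not_commutation_and_long_braid)
  finally show ?thesis .
qed

lemma diam_B_graph: "diam (B_graph n p) = wdiam (move_cost 1 0) (reduced_words n p)"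
proof -
  have "diam (B_graph n p) = wdiam (contract_cost (long_braid_edges n p)
      (parcs (G_graph n p) - long_braid_edges n p)) (pverts (G_graph n p))"
    unfolding B_graph_def
    by (rule diam_contract_edges[OF _ G_graph_wf])
       (auto simp: G_graph_def long_braid_edges_def sym_def long_braid_move_sym)
  also have "\<dots> = wdiam (move_cost 1 0) (reduced_words n p)"
    by (simp add: G_graph_def, rule wdiam_move_cost)
       (auto simp: contract_cost_def move_cost_def commutation_edges_def long_braid_edges_def
          dest: not_commutation_and_long_braid)
  finally show ?thesis .
qed

section \<open>Shuffles\<close>

text \<open>Counts pairs of positions in which a \<open>P\<close>-letter precedes a letter outside
  \<open>P\<close>. For \<open>P r = (a < r)\<close> these are the pairs with a letter of the second
  factor before one of the first.\<close>

fun crossings :: "('a \<Rightarrow> bool) \<Rightarrow> 'a list \<Rightarrow> nat" where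
  "crossings P [] = 0"
| "crossings P (x # w) = (if P x then length (filter (\<lambda>y. \<not> P y) w) else 0) + crossings P w"

lemma crossings_append:
  "crossings P (v @ w) =
     crossings P v + crossings P w + length (filter P v) * length (filter (\<lambda>y. \<not> P y) w)"
  by (induction v) auto

text \<open>Each pair of a \<open>P\<close>-letter and a letter outside \<open>P\<close> occurs in
  exactly one of the two orders.\<close>

lemma crossings_add_swap:
  "crossings P w + crossings (\<lambda>x. \<not> P x) w = length (filter P w) * length (filter (\<lambda>x. \<not> P x) w)"
  by (induction w) (auto simp: algebra_simps)

lemma crossings_eq_0: "\<forall>x\<in>set w. P x \<Longrightarrow> crossings P w = 0" "\<forall>x\<in>set w. \<not> P x \<Longrightarrow> crossings P w = 0"
  by (induction w) (auto simp: filter_empty_conv)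

section \<open>Sorting words by commutations\<close>

lemma wpath_append:
  "wpath (move_cost c d) v k w \<Longrightarrow> wpath (move_cost c d) (xs @ v @ ys) k (xs @ w @ ys)"
  using wpath_map[of "move_cost c d" v k w "move_cost c d" "\<lambda>z. xs @ z @ ys"] move_cost_append by blast

lemma wpath_pass:
  assumes "\<forall>y\<in>set w. \<bar>int x - int y\<bar> > 1"
  shows "wpath (move_cost c d) (x # w) (c * length w) (w @ [x])"
  using assms
proof (induction w)
  case (Cons y w)
  have "wpath (move_cost c d) (x # y # w) c (y # x # w)"
    using Cons.prems move_cost_commutation[of x y c d "[]" w] by (auto intro: wpath_edge)
  moreover have "wpath (move_cost c d) (y # x # w) (c * length w) (y # w @ [x])"
    using Cons wpath_append[of c d "x # w" "c * length w" "w @ [x]" "[y]" "[]"] by simp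
  ultimately show ?case using wpath_trans by fastforce
qed (simp add: wpath.refl)

text \<open>Insertion sort: the tail is sorted first, then a head in \<open>P\<close> passes the
  letters outside \<open>P\<close>. The number of swaps is the term that the recursion of
  \<open>crossings\<close> adds.\<close>

lemma wpath_sort:
  assumes "\<And>x y. x \<in> set w \<Longrightarrow> y \<in> set w \<Longrightarrow> P x \<Longrightarrow> \<not> P y \<Longrightarrow> \<bar>int x - int y\<bar> > 1"
  shows "wpath (move_cost c d) w (c * crossings P w) (filter (\<lambda>x. \<not> P x) w @ filter P w)"
  using assms
proof (induction w)
  case (Cons x w)
  let ?N = "filter (\<lambda>x. \<not> P x) w" and ?P = "filter P w"
  have *: "wpath (move_cost c d) (x # w) (c * crossings P w) (x # ?N @ ?P)"
    using Cons wpath_append[of c d w _ "?N @ ?P" "[x]" "[]"] by simp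
  show ?case
  proof (cases "P x")
    case True
    then have "wpath (move_cost c d) (x # ?N) (c * length ?N) (?N @ [x])"
      using Cons.prems by (intro wpath_pass) auto
    then have "wpath (move_cost c d) (x # ?N @ ?P) (c * length ?N) (?N @ x # ?P)"
      using wpath_append[of c d "x # ?N" _ "?N @ [x]" "[]" ?P] by simp
    from wpath_trans[OF this *] show ?thesis using True by (simp add: algebra_simps)
  qed (use * in simp)
qed (simp add: wpath.refl)

text \<open>The negated form makes this filter the literal complement of the one in
  \<open>upper_part\<close>. The letter \<open>a\<close> would count as lower, but it is absent from
  the words considered.\<close>

definition lower_part :: "nat \<Rightarrow> nat list \<Rightarrow> nat list" where
  "lower_part a w = filter (\<lambda>r. \<not> a < r) w"

definition upper_part :: "nat \<Rightarrow> nat list \<Rightarrow> nat list" where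
  "upper_part a w = map (\<lambda>r. r - a) (filter (\<lambda>r. a < r) w)"

abbreviation shift :: "nat \<Rightarrow> nat list \<Rightarrow> nat list" where
  "shift a w \<equiv> map (\<lambda>r. r + a) w"

lemma shift_upper_part: "shift a (upper_part a w) = filter (\<lambda>r. a < r) w"
  unfolding upper_part_def by (induction w) auto

text \<open>A move acts on letters on one side of \<open>a\<close>, and then on one part only, or it
  is a mixed commutation. The number \<open>m\<close> is 0 or 1 and bounds the increase of
  \<open>crossings\<close>.\<close>

lemma parts_move_cost:
  assumes "move_cost c d v k w" and "a \<notin> set v"
  shows "\<exists>k1 k2 m. wpath (move_cost c d) (lower_part a v) k1 (lower_part a w) \<and>
     wpath (move_cost c d) (upper_part a v) k2 (upper_part a w) \<and>
     crossings (\<lambda>r. a < r) w \<le> crossings (\<lambda>r. a < r) v + m \<and> k = k1 + k2 + c * m"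
proof -
  let ?P = "\<lambda>r. a < r"
  have low: ?thesis
    if "v = xs @ v' @ ys" "w = xs @ w' @ ys" "\<forall>x\<in>set v' \<union> set w'. \<not> a < x" "move_cost c d v' k w'"
    for xs ys v' w'
  proof -
    have "filter (\<lambda>r. \<not> ?P r) v' = v'" "filter (\<lambda>r. \<not> ?P r) w' = w'"
      "filter ?P v' = []" "filter ?P w' = []" "crossings ?P v' = 0" "crossings ?P w' = 0"
      using that(3) by (auto simp: filter_id_conv filter_empty_conv crossings_eq_0)
    \<comment> \<open>The replaced windows have equal length, so the product terms of
      \<open>crossings_append\<close> do not change.\<close>
    then have parts: "lower_part a v = lower_part a xs @ v' @ lower_part a ys"
      "lower_part a w = lower_part a xs @ w' @ lower_part a ys"
      "upper_part a w = upper_part a v" "crossings ?P w = crossings ?P v"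
      using that(1,2) move_cost_length[OF that(4)]
      by (simp_all add: lower_part_def upper_part_def crossings_append)
    have "wpath (move_cost c d) (lower_part a v) k (lower_part a w)"
      unfolding parts by (intro wpath_append wpath_edge that(4))
    then show ?thesis unfolding parts(3,4)
      by (intro exI[of _ k] exI[of _ 0]) (simp add: wpath.refl)
  qed
  have up: ?thesis
    if "v = xs @ v' @ ys" "w = xs @ w' @ ys" "\<forall>x\<in>set v' \<union> set w'. a < x" "move_cost c d v' k w'"
    for xs ys v' w'
  proof -
    have "filter ?P v' = v'" "filter ?P w' = w'"
      "filter (\<lambda>r. \<not> ?P r) v' = []" "filter (\<lambda>r. \<not> ?P r) w' = []"
      "crossings ?P v' = 0" "crossings ?P w' = 0"
      using that(3) by (auto simp: filter_id_conv filter_empty_conv crossings_eq_0)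
    \<comment> \<open>All letters of the window exceed \<open>a\<close>, so truncated subtraction
      preserves their differences.\<close>
    moreover have "move_cost c d (map (\<lambda>r. r - a) v') k (map (\<lambda>r. r - a) w')"
    proof (rule move_cost_map[OF that(4)])
      fix i j assume "i \<in> set v'" "j \<in> set v'"
      then have "a \<le> i" "a \<le> j" using that(3) by (auto intro: less_imp_le)
      then show "int (i - a) - int (j - a) = int i - int j" by simp
    qed
    ultimately have parts: "lower_part a w = lower_part a v" "crossings ?P w = crossings ?P v"
      and "upper_part a v = upper_part a xs @ map (\<lambda>r. r - a) v' @ upper_part a ys"
      "upper_part a w = upper_part a xs @ map (\<lambda>r. r - a) w' @ upper_part a ys"
      and "move_cost c d (map (\<lambda>r. r - a) v') k (map (\<lambda>r. r - a) w')"
      using that(1,2) move_cost_length[OF that(4)]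
      by (simp_all add: lower_part_def upper_part_def crossings_append)
    then have "wpath (move_cost c d) (upper_part a v) k (upper_part a w)"
      by (simp only: wpath_append wpath_edge)
    then show ?thesis unfolding parts
      by (rule_tac x = 0 in exI, rule_tac x = k in exI, rule_tac x = 0 in exI) (simp add: wpath.refl)
  qed
  from assms(1) show ?thesis
  proof (cases rule: move_cost_cases)
    case (commutation xs ys i j)
    then have mv: "move_cost c d [i, j] k [j, i]"
      using move_cost_commutation[of i j c d "[]" "[]"] by simp
    consider "a < i \<longleftrightarrow> a < j" | "(a < i) \<noteq> (a < j)" by blast
    then show ?thesis
    proof cases
      case 1
      then show ?thesis using low[OF commutation(3,4) _ mv] up[OF commutation(3,4) _ mv] by auto
    next
      case 2
      \<comment> \<open>Each part keeps just one of the two swapped letters and does not see the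
        swap.\<close>
      then have "lower_part a w = lower_part a v" "upper_part a w = upper_part a v"
        "crossings ?P w \<le> crossings ?P v + 1"
        by (auto simp: commutation lower_part_def upper_part_def crossings_append)
      then show ?thesis using commutation(2) wpath.refl[of "move_cost c d" "lower_part a v"]
          wpath.refl[of "move_cost c d" "upper_part a v"]
        by (metis add_0 mult_1_right)
    qed
  next
    case (braid xs ys i j)
    then have mv: "move_cost c d [i, j, i] k [j, i, j]"
      using move_cost_braid[of j i c d "[]" "[]"] by simp
    \<comment> \<open>Consecutive letters different from \<open>a\<close> lie on the same side of
      it.\<close>
    have "a < i \<longleftrightarrow> a < j" using braid assms(2) by auto
    then show ?thesis using low[OF braid(3,4) _ mv] up[OF braid(3,4) _ mv] by auto
  qed
qed

text \<open>The absence of \<open>a\<close> from \<open>w\<close> is carried along because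
  \<open>parts_move_cost\<close> requires it at every step.\<close>

lemma parts_wpath:
  assumes "wpath (move_cost c d) v k w" and "a \<notin> set v"
  shows "\<exists>k1 k2 m. wpath (move_cost c d) (lower_part a v) k1 (lower_part a w) \<and>
     wpath (move_cost c d) (upper_part a v) k2 (upper_part a w) \<and>
     crossings (\<lambda>r. a < r) w \<le> crossings (\<lambda>r. a < r) v + m \<and> k = k1 + k2 + c * m \<and> a \<notin> set w"
  using assms
proof (induction rule: wpath.induct)
  case (refl u)
  then show ?case using wpath.refl by (intro exI[of _ 0]) auto
next
  case (step u k v l w)
  then obtain k1 k2 m where *: "wpath (move_cost c d) (lower_part a u) k1 (lower_part a v)"
     "wpath (move_cost c d) (upper_part a u) k2 (upper_part a v)"
     "crossings (\<lambda>r. a < r) v \<le> crossings (\<lambda>r. a < r) u + m" "k = k1 + k2 + c * m" "a \<notin> set v"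
    by blast
  then obtain l1 l2 m' where **: "wpath (move_cost c d) (lower_part a v) l1 (lower_part a w)"
     "wpath (move_cost c d) (upper_part a v) l2 (upper_part a w)"
     "crossings (\<lambda>r. a < r) w \<le> crossings (\<lambda>r. a < r) v + m'" "l = l1 + l2 + c * m'"
    using parts_move_cost[OF step(2)] by blast
  note wpath_trans[OF **(1) *(1)] wpath_trans[OF **(2) *(2)]
  moreover have "a \<notin> set w" using *(5) move_cost_set[OF step(2)] by simp
  moreover have "crossings (\<lambda>r. a < r) w \<le> crossings (\<lambda>r. a < r) u + (m + m')"
    using *(3) **(3) by linarith
  moreover have "k + l = (k1 + l1) + (k2 + l2) + c * (m + m')"
    using *(4) **(4) by (simp add: algebra_simps)
  ultimately show ?case by blast
qed

section \<open>Bounds for the distance between shuffles\<close>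

lemma wpath_shift:
  "wpath (move_cost c d) v k w \<Longrightarrow> wpath (move_cost c d) (shift a v) k (shift a w)"
  by (erule wpath_map) (auto intro: move_cost_map)

text \<open>The first word has no crossings and the second has \<open>length x' * length y'\<close>.
  Any path needs at least that many mixed commutations besides its two projected paths.\<close>

lemma wdist_shuffle_ge:
  assumes "set x \<subseteq> {..<a}" "set x' \<subseteq> {..<a}" "0 \<notin> set y" "0 \<notin> set y'"
  shows "wdist (move_cost c d) x x' + wdist (move_cost c d) y y' + enat (c * (length x' * length y'))
     \<le> wdist (move_cost c d) (x @ shift a y) (shift a y' @ x')"
proof (rule wdist_greatest)
  fix k assume k: "wpath (move_cost c d) (x @ shift a y) k (shift a y' @ x')"
  have f: "filter (\<lambda>r. a < r) z = []" "filter (\<lambda>r. \<not> a < r) z = z" if "set z \<subseteq> {..<a}" for z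
    using that by (auto simp: filter_empty_conv filter_id_conv)
  \<comment> \<open>A letter 0 would be shifted to \<open>a\<close> and fall into the lower
    part.\<close>
  have g: "filter (\<lambda>r. a < r) (shift a z) = shift a z" "filter (\<lambda>r. \<not> a < r) (shift a z) = []"
    if "0 \<notin> set z" for z
    using that by (auto simp: filter_empty_conv filter_id_conv intro!: gr0I)
  have z: "crossings (\<lambda>r. a < r) x = 0" "crossings (\<lambda>r. a < r) x' = 0"
    by (rule crossings_eq_0(2); use assms in auto)+
  have z': "crossings (\<lambda>r. a < r) (shift a y) = 0" "crossings (\<lambda>r. a < r) (shift a y') = 0"
    by (rule crossings_eq_0(1); use assms in \<open>auto intro!: gr0I\<close>)+
  have "a \<notin> set (x @ shift a y)" using assms by auto
  from parts_wpath[OF k this] obtain k1 k2 m where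
    "wpath (move_cost c d) x k1 x'" "wpath (move_cost c d) y k2 y'"
    "length x' * length y' \<le> m" "k = k1 + k2 + c * m"
    using assms by (auto simp: lower_part_def upper_part_def crossings_append f g z z' comp_def mult.commute)
  moreover from this have "c * (length x' * length y') \<le> c * m" by (intro mult_le_mono2)
  ultimately show "wdist (move_cost c d) x x' + wdist (move_cost c d) y y' +
      enat (c * (length x' * length y')) \<le> enat k"
    using wdist_le add_mono by (metis enat_ord_simps(1) plus_enat_simps(1))
qed

text \<open>
  The detours through the two extreme shuffles cost \<open>2 * c * (length x * length y)\<close> mixed
  commutations in total, so the cheaper one costs at most half of that.
\<close>

lemma wdist_shuffle_le:
  assumes "a \<notin> set u" "a \<notin> set v"
    and len: "length (lower_part a v) = length (lower_part a u)"
      "length (upper_part a v) = length (upper_part a u)"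
  shows "wdist (move_cost c d) u v \<le>
     wdist (move_cost c d) (lower_part a u) (lower_part a v) +
     wdist (move_cost c d) (upper_part a u) (upper_part a v) +
     enat (c * (length (lower_part a u) * length (upper_part a u)))"
proof (cases "wdist (move_cost c d) (lower_part a u) (lower_part a v) = \<infinity> \<or>
    wdist (move_cost c d) (upper_part a u) (upper_part a v) = \<infinity>")
  case False
  let ?W = "move_cost c d" and ?P = "\<lambda>r. a < r" and ?Q = "\<lambda>r. \<not> a < r"
  let ?N = "length (lower_part a u) * length (upper_part a u)"
  obtain k1 where k1: "wpath ?W (lower_part a u) k1 (lower_part a v)"
      "wdist ?W (lower_part a u) (lower_part a v) = enat k1"
    using False wdist_attained by metis
  obtain k2 where k2: "wpath ?W (upper_part a u) k2 (upper_part a v)"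
      "wdist ?W (upper_part a u) (upper_part a v) = enat k2"
    using False wdist_attained by metis
  have low: "wpath ?W (filter ?Q u) k1 (filter ?Q v)"
    using k1(1) by (simp add: lower_part_def)
  have up: "wpath ?W (filter ?P u) k2 (filter ?P v)"
    using wpath_shift[OF k2(1), of a] unfolding shift_upper_part .
  \<comment> \<open>Since \<open>a\<close> is absent, letters on opposite sides of it differ by at
    least 2.\<close>
  have far: "\<bar>int x - int y\<bar> > 1"
    if "z \<in> {u, v}" "x \<in> set z" "y \<in> set z" "(a < x) \<noteq> (a < y)" for x y z
    using that assms(1,2) by (cases "x = a"; cases "y = a") auto
  have both: "wpath ?W (xs @ ys) (k + l) (xs' @ ys')" if "wpath ?W xs k xs'" "wpath ?W ys l ys'"
    for xs ys xs' ys' k l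
  proof -
    have "wpath ?W (xs @ ys) k (xs' @ ys)" "wpath ?W (xs' @ ys) l (xs' @ ys')"
      using wpath_append[OF that(1), of "[]" ys] wpath_append[OF that(2), of xs' "[]"] by simp_all
    then show ?thesis using wpath_trans by metis
  qed
  have sortP: "wpath ?W z (c * crossings ?P z) (filter ?Q z @ filter ?P z)" if "z \<in> {u, v}" for z
    by (rule wpath_sort) (use far[OF that] in blast)
  have sortQ: "wpath ?W z (c * crossings ?Q z) (filter ?P z @ filter ?Q z)" if "z \<in> {u, v}" for z
  proof -
    have "wpath ?W z (c * crossings ?Q z) (filter (\<lambda>r. \<not> ?Q r) z @ filter ?Q z)"
      by (rule wpath_sort) (use far[OF that] in blast)
    then show ?thesis by simp
  qed
  \<comment> \<open>The path from \<open>v\<close> to \<open>z'\<close> is traversed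
    backwards.\<close>
  have via: "wpath ?W u (i + k + j) v" if "wpath ?W u i z" "wpath ?W z k z'" "wpath ?W v j z'"
    for i j k z z'
    using wpath_trans[OF wpath_sym[OF that(3) move_cost_sym] wpath_trans[OF that(2,1)]] by simp
  have P: "wpath ?W u (c * crossings ?P u + (k1 + k2) + c * crossings ?P v) v"
    by (rule via[OF sortP both[OF low up] sortP]) auto
  have Q: "wpath ?W u (c * crossings ?Q u + (k2 + k1) + c * crossings ?Q v) v"
    by (rule via[OF sortQ both[OF up low] sortQ]) auto
  have N: "crossings ?P u + crossings ?Q u = ?N" "crossings ?P v + crossings ?Q v = ?N"
    unfolding crossings_add_swap using len by (simp_all add: lower_part_def upper_part_def)
  consider "crossings ?P u + crossings ?P v \<le> ?N" | "crossings ?Q u + crossings ?Q v \<le> ?N"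
    using N by linarith
  then have "\<exists>k. wpath ?W u k v \<and> k \<le> k1 + k2 + c * ?N"
  proof cases
    case 1
    then have "c * (crossings ?P u + crossings ?P v) \<le> c * ?N" by (rule mult_le_mono2)
    then show ?thesis using P by (intro exI conjI) (auto simp: algebra_simps)
  next
    case 2
    then have "c * (crossings ?Q u + crossings ?Q v) \<le> c * ?N" by (rule mult_le_mono2)
    then show ?thesis using Q by (intro exI conjI) (auto simp: algebra_simps)
  qed
  then show ?thesis
    unfolding k1(2) k2(2) plus_enat_simps(1)
    using order_trans[OF wdist_le[of ?W u _ v]] enat_ord_simps(1) by blast
qed auto

section \<open>Inversions and reduced words\<close>

lemma finite_inversions: "finite (inversions n p)"
  by (rule finite_subset[of _ "{..n} \<times> {..n}"]) (auto simp: inversions_def)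

lemma perm_length_id [simp]: "perm_length n id = 0"
  by (auto simp: perm_length_def inversions_def intro!: card_eq_0_iff[THEN iffD2])

lemma adj_transp_permutes: "1 \<le> r \<Longrightarrow> r < n \<Longrightarrow> adj_transp r permutes {1..n}"
  unfolding adj_transp_def by (rule permutes_swap_id) auto

lemma adj_transp_adj_transp [simp]: "adj_transp r \<circ> (adj_transp r \<circ> p) = p"
  by (simp add: adj_transp_def fun_eq_iff)

lemma word_perm_permutes: "set w \<subseteq> {1..n - 1} \<Longrightarrow> word_perm w permutes {1..n}"
proof (induction w)
  case (Cons r w)
  then have "word_perm w permutes {1..n}" "1 \<le> r" "r < n" by auto
  then have "word_perm w permutes {1..n}" "adj_transp r permutes {1..n}"
    using adj_transp_permutes by blast+
  then show ?case unfolding word_perm_Cons by (rule permutes_compose)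
qed (simp add: permutes_id)

text \<open>Composition on the left swaps the values \<open>r\<close> and \<open>r + 1\<close>. No
  other value lies between them, so only the pair of their positions changes its order.\<close>

lemma inversions_adj_transp:
  assumes p: "p permutes {1..n}" and r: "1 \<le> r" "r < n"
    and ij: "p i = r" "p j = r + 1" "i < j"
  shows "inversions n (adj_transp r \<circ> p) = insert (i, j) (inversions n p)"
    and "(i, j) \<notin> inversions n p"
proof -
  have mem: "i \<in> {1..n}" "j \<in> {1..n}"
    using permutes_in_image[OF p, of i] permutes_in_image[OF p, of j] ij r by auto
  have i: "p x = r \<longleftrightarrow> x = i" and j: "p x = r + 1 \<longleftrightarrow> x = j" for x
    using injD[OF permutes_inj[OF p], of x i] injD[OF permutes_inj[OF p], of x j] ij by auto
  have val: "(adj_transp r \<circ> p) x = (if x = i then r + 1 else if x = j then r else p x)" for x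
    using i[of x] j[of x] by (auto simp: adj_transp_def transpose_def)
  have "(x, y) \<in> inversions n (adj_transp r \<circ> p) \<longleftrightarrow> (x, y) \<in> insert (i, j) (inversions n p)" for x y
    using mem ij i[of x] j[of x] i[of y] j[of y] unfolding inversions_def val
    by (cases "x = i"; cases "x = j"; cases "y = i"; cases "y = j") auto
  then show "inversions n (adj_transp r \<circ> p) = insert (i, j) (inversions n p)" by auto
  show "(i, j) \<notin> inversions n p" using ij by (auto simp: inversions_def)
qed

lemma adj_transp_inversions_cases:
  assumes p: "p permutes {1..n}" and r: "1 \<le> r" "r < n"
  obtains i j where "p i = r" "p j = r + 1" "i < j" "(i, j) \<notin> inversions n p"
      "inversions n (adj_transp r \<circ> p) = insert (i, j) (inversions n p)"
  | i j where "p i = r" "p j = r + 1" "j < i" "(j, i) \<notin> inversions n (adj_transp r \<circ> p)"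
      "inversions n p = insert (j, i) (inversions n (adj_transp r \<circ> p))"
proof -
  obtain i j where ij: "p i = r" "p j = r + 1"
    using permutes_surj[OF p] by (metis surjD)
  then have "i \<noteq> j" by auto
  then consider "i < j" | "j < i" by linarith
  then show thesis
  proof cases
    case 1
    then show ?thesis using that(1) inversions_adj_transp[OF p r ij] ij by blast
  next
    case 2
    \<comment> \<open>As \<open>adj_transp r\<close> is an involution, this is the first case for
      \<open>?q\<close>.\<close>
    let ?q = "adj_transp r \<circ> p"
    have "?q permutes {1..n}" using p adj_transp_permutes[OF r] by (rule permutes_compose)
    moreover have "?q j = r" "?q i = r + 1" using ij by (auto simp: adj_transp_def)
    ultimately show ?thesis
      using that(2) inversions_adj_transp[of ?q n r j i] r ij 2 by simp
  qed
qed

lemma perm_length_word_perm_le: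
  "set w \<subseteq> {1..n - 1} \<Longrightarrow> perm_length n (word_perm w) \<le> length w"
proof (induction w)
  case (Cons r w)
  then have "word_perm w permutes {1..n}" "1 \<le> r" "r < n"
    using word_perm_permutes[of w n] by auto
  then have "card (inversions n (adj_transp r \<circ> word_perm w)) \<le> Suc (perm_length n (word_perm w))"
    by (cases rule: adj_transp_inversions_cases)
       (simp_all add: perm_length_def finite_inversions)
  then show ?case using Cons unfolding word_perm_Cons perm_length_def by simp
qed simp

text \<open>If the head destroyed an inversion, the permutation of the tail would have
  \<open>length w + 2\<close> inversions, against \<open>perm_length_word_perm_le\<close>.\<close>

lemma reduced_words_ConsE:
  assumes "r # w \<in> reduced_words n p"
  obtains i j where "w \<in> reduced_words n (word_perm w)" "word_perm w i = r" "word_perm w j = r + 1"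
    "i < j" "inversions n p = insert (i, j) (inversions n (word_perm w))"
proof -
  have w: "set w \<subseteq> {1..n - 1}" and r: "1 \<le> r" "r < n"
    and p: "p = adj_transp r \<circ> word_perm w" and len: "Suc (length w) = perm_length n p"
    using assms by (auto simp: reduced_words_def)
  have le: "perm_length n (word_perm w) \<le> length w" using w by (rule perm_length_word_perm_le)
  from word_perm_permutes[OF w] r show thesis
  proof (cases rule: adj_transp_inversions_cases)
    case (1 i j)
    then have "perm_length n (word_perm w) = length w"
      using len finite_inversions by (simp add: perm_length_def p)
    then show ?thesis using that 1 w p by (auto simp: reduced_words_def)
  next
    case (2 i j)
    then have "perm_length n (word_perm w) = Suc (perm_length n p)"
      using finite_inversions by (simp add: perm_length_def p)
    then show ?thesis using le len by simp
  qed
qed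

text \<open>Only the letter \<open>a\<close> moves values across the cut between \<open>a\<close>
  and \<open>a + 1\<close>.\<close>

lemma word_perm_le_iff: "a \<notin> set w \<Longrightarrow> word_perm w i \<le> a \<longleftrightarrow> i \<le> a"
proof (induction w)
  case (Cons r w)
  then have "adj_transp r (word_perm w i) \<le> a \<longleftrightarrow> word_perm w i \<le> a"
    by (auto simp: adj_transp_def transpose_def)
  then show ?case using Cons by simp
qed simp

text \<open>
  Along a reduced word, read from the right, the set of inversions only grows; the first
  occurrence of the letter \<open>a\<close> creates an inversion across the cut after position \<open>a\<close>.
\<close>

lemma reduced_word_crossing_inversion:
  "w \<in> reduced_words n p \<Longrightarrow> a \<in> set w \<Longrightarrow> \<exists>i j. i \<le> a \<and> a < j \<and> (i, j) \<in> inversions n p"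
proof (induction w arbitrary: p)
  case (Cons r w)
  from Cons.prems(1) obtain i j where *: "w \<in> reduced_words n (word_perm w)"
    "word_perm w i = r" "word_perm w j = r + 1"
    "inversions n p = insert (i, j) (inversions n (word_perm w))"
    by (rule reduced_words_ConsE)
  show ?case
  proof (cases "a \<in> set w")
    case True
    then show ?thesis using Cons.IH[OF *(1)] *(4) by blast
  next
    case False
    \<comment> \<open>The head is the only occurrence of \<open>a\<close>. The tail respects the
      cut, so the values \<open>a\<close> and \<open>a + 1\<close> come from opposite sides of
      it.\<close>
    then have "r = a" using Cons.prems(2) by simp
    then have "i \<le> a" "a < j"
      using word_perm_le_iff[OF False, of i] word_perm_le_iff[OF False, of j] * by auto
    then show ?thesis using *(4) by blast
  qed
qed simp

text \<open>Without descents, induction gives \<open>r \<le> p r\<close> throughout, which forces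
  the identity.\<close>

lemma permutes_descent:
  fixes p :: "nat \<Rightarrow> nat"
  assumes p: "p permutes {1..n}" and "p \<noteq> id"
  obtains (descent) r where "1 \<le> r" "r < n" "p (r + 1) < p r"
proof (rule ccontr)
  assume no: "\<not> thesis"
  have asc: "p r \<le> p (r + 1)" if "1 \<le> r" "r < n" for r
  proof (rule ccontr)
    assume "\<not> p r \<le> p (r + 1)"
    then show False using descent[OF that] no by simp
  qed
  have "r \<le> n \<longrightarrow> r \<le> p r" if "1 \<le> r" for r
    using that
  proof (induction r rule: dec_induct)
    case base
    then show ?case using permutes_in_image[OF p, of 1] by auto
  next
    case (step r)
    have "p r \<noteq> p (r + 1)" using injD[OF permutes_inj[OF p], of r "r + 1"] by auto
    then show ?case using asc[of r] step by auto
  qed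
  then have "p = id" by (intro permutes_natset_ge[OF p]) auto
  then show False using assms(2) by simp
qed

text \<open>Nonemptiness is what allows the suprema in the lower bound to be combined by
  \<open>enat_SUP_add_le\<close>.\<close>

lemma reduced_words_nonempty: "p permutes {1..n} \<Longrightarrow> reduced_words n p \<noteq> {}"
proof (induction "perm_length n p" arbitrary: p rule: less_induct)
  case less
  show ?case
  proof (cases "p = id")
    case True
    then have "[] \<in> reduced_words n p"
      by (simp add: reduced_words_def)
    then show ?thesis by blast
  next
    case False
    \<comment> \<open>Letters added on the left swap values, so a descent of the inverse is the one
      that shortens \<open>p\<close>.\<close>
    then have "inv p \<noteq> id" using inv_inv_eq[OF permutes_bij[OF less.prems]] by force
    with permutes_inv[OF less.prems] obtain r where
      r: "1 \<le> r" "r < n" and desc: "inv p (r + 1) < inv p r"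
      by (rule permutes_descent)
    let ?q = "adj_transp r \<circ> p"
    have q: "?q permutes {1..n}" using less.prems adj_transp_permutes[OF r] by (rule permutes_compose)
    have len: "perm_length n p = Suc (perm_length n ?q)"
      using less.prems r
    proof (cases rule: adj_transp_inversions_cases)
      case (1 i j)
      then have "inv p r = i" "inv p (r + 1) = j" using permutes_inverses(2)[OF less.prems] by metis+
      then show ?thesis using desc 1 by simp
    next
      case (2 i j)
      then show ?thesis using finite_inversions by (simp add: perm_length_def)
    qed
    obtain w where "w \<in> reduced_words n ?q" using less.hyps[OF _ q] len by auto
    then have "r # w \<in> reduced_words n p"
      using r len by (auto simp: reduced_words_def)
    then show ?thesis by blast
  qed
qed

section \<open>Reduced words of an inflation\<close>

text \<open>No inversion crosses the cut after position \<open>a\<close>: values are at most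
  \<open>a\<close> before it and at least \<open>a\<close> after it.\<close>

lemma perm_length_inflation12:
  assumes \<alpha>: "\<alpha> permutes {1..a}" and \<beta>: "\<beta> permutes {1..b}"
  shows "perm_length (a + b) (inflation12 a b \<alpha> \<beta>) = perm_length a \<alpha> + perm_length b \<beta>"
proof -
  let ?s = "\<lambda>(i, j). (i + a, j + a)"
  have \<alpha>_le: "\<alpha> i \<le> a" if "1 \<le> i" "i \<le> a" for i
    using permutes_in_image[OF \<alpha>, of i] that by auto
  have "inversions (a + b) (inflation12 a b \<alpha> \<beta>) = inversions a \<alpha> \<union> ?s ` inversions b \<beta>" (is "?I = ?J")
  proof (intro equalityI subsetI)
    fix z assume "z \<in> ?I"
    then obtain i j where z: "z = (i, j)" "1 \<le> i" "i < j" "j \<le> a + b"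
        "inflation12 a b \<alpha> \<beta> j < inflation12 a b \<alpha> \<beta> i"
      by (auto simp: inversions_def)
    consider "j \<le> a" | "i \<le> a" "a < j" | "a < i" using z(3) by linarith
    then show "z \<in> ?J"
    proof cases
      case 1
      then show ?thesis using z by (auto simp: inversions_def inflation12_def)
    next
      case 2
      then show ?thesis using z \<alpha>_le[of i] by (auto simp: inflation12_def)
    next
      case 3
      then have "(i - a, j - a) \<in> inversions b \<beta>" using z by (auto simp: inversions_def inflation12_def)
      moreover have "z = ?s (i - a, j - a)" using z 3 by simp
      ultimately show ?thesis by blast
    qed
  qed (auto simp: inversions_def inflation12_def)
  moreover have "inversions a \<alpha> \<inter> ?s ` inversions b \<beta> = {}" by (auto simp: inversions_def)
  moreover have "inj_on ?s (inversions b \<beta>)" by (auto simp: inj_on_def)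
  ultimately show ?thesis
    by (simp add: perm_length_def card_Un_disjoint card_image finite_inversions)
qed

lemma inflation12_inject:
  assumes "\<alpha> permutes {1..a}" "\<alpha>' permutes {1..a}" "\<beta> permutes {1..b}" "\<beta>' permutes {1..b}"
    and eq: "inflation12 a b \<alpha> \<beta> = inflation12 a b \<alpha>' \<beta>'"
  shows "\<alpha> = \<alpha>'" and "\<beta> = \<beta>'"
proof -
  show "\<alpha> = \<alpha>'"
  proof
    fix i show "\<alpha> i = \<alpha>' i"
      using fun_cong[OF eq, of i] permutes_not_in[OF assms(1), of i] permutes_not_in[OF assms(2), of i]
      by (cases "i \<in> {1..a}") (auto simp: inflation12_def)
  qed
  show "\<beta> = \<beta>'"
  proof
    fix i show "\<beta> i = \<beta>' i"
      using fun_cong[OF eq, of "i + a"] permutes_not_in[OF assms(3), of i] permutes_not_in[OF assms(4), of i]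
      by (cases "i \<in> {1..b}") (auto simp: inflation12_def)
  qed
qed

text \<open>A letter 0 would be shifted to \<open>a\<close> and move position
  \<open>a\<close>.\<close>

lemma word_perm_shift:
  assumes "0 \<notin> set w"
  shows "word_perm (shift a w) i = (if i \<le> a then i else word_perm w (i - a) + a)"
  using assms
proof (induction w)
  case (Cons r w)
  have "0 < word_perm w (i - a)" if "a < i"
    using word_perm_le_iff[of 0 w "i - a"] Cons.prems that by auto
  then show ?case using Cons by (auto simp: adj_transp_def transpose_def)
qed auto

lemma word_perm_append_shift:
  assumes "set x \<subseteq> {1..a - 1}" and "set y \<subseteq> {1..b - 1}"
  shows "word_perm (x @ shift a y) = inflation12 a b (word_perm x) (word_perm y)"
    and "word_perm (shift a y @ x) = inflation12 a b (word_perm x) (word_perm y)"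
proof -
  have x: "word_perm x i = i" if "i \<notin> {1..a}" for i
    using permutes_not_in[OF word_perm_permutes[OF assms(1)] that] .
  have y: "word_perm y i = i" if "b < i" for i
    using permutes_not_in[OF word_perm_permutes[OF assms(2)], of i] that by simp
  have "0 \<notin> set y" using assms(2) by auto
  note sh = word_perm_shift[OF this, of a]
  have pos: "0 < word_perm y i" if "0 < i" for i
    using word_perm_le_iff[OF \<open>0 \<notin> set y\<close>, of i] that by auto
  have le: "word_perm x i \<le> a \<longleftrightarrow> i \<le> a" for i
  proof (rule word_perm_le_iff, rule notI)
    assume "a \<in> set x"
    then have "a \<in> {1..a - 1}" using assms(1) by blast
    then show False by auto
  qed
  show "word_perm (x @ shift a y) = inflation12 a b (word_perm x) (word_perm y)"
  proof
    fix i
    consider "i = 0" | "1 \<le> i" "i \<le> a" | "a < i" "i \<le> a + b" | "a + b < i" by linarith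
    then show "word_perm (x @ shift a y) i = inflation12 a b (word_perm x) (word_perm y) i"
      using x[of i] x[of "word_perm y (i - a) + a"] y[of "i - a"] pos[of "i - a"]
      by cases (auto simp: sh inflation12_def)
  qed
  show "word_perm (shift a y @ x) = inflation12 a b (word_perm x) (word_perm y)"
  proof
    fix i
    consider "i = 0" | "1 \<le> i" "i \<le> a" | "a < i" "i \<le> a + b" | "a + b < i" by linarith
    then show "word_perm (shift a y @ x) i = inflation12 a b (word_perm x) (word_perm y) i"
      using x[of i] y[of "i - a"] le[of i] by cases (auto simp: sh inflation12_def)
  qed
qed

text \<open>These are the extreme shuffles between which the lower bound is measured.\<close>

lemma shuffle_reduced_words:
  assumes "\<alpha> permutes {1..a}" "\<beta> permutes {1..b}"
    and x: "x \<in> reduced_words a \<alpha>" and y: "y \<in> reduced_words b \<beta>"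
  shows "x @ shift a y \<in> reduced_words (a + b) (inflation12 a b \<alpha> \<beta>)"
    and "shift a y @ x \<in> reduced_words (a + b) (inflation12 a b \<alpha> \<beta>)"
proof -
  have s: "set x \<subseteq> {1..a - 1}" "set y \<subseteq> {1..b - 1}"
    using x y by (auto simp: reduced_words_def)
  then have "set x \<union> set (shift a y) \<subseteq> {1..a + b - 1}" by fastforce
  then show "x @ shift a y \<in> reduced_words (a + b) (inflation12 a b \<alpha> \<beta>)"
    and "shift a y @ x \<in> reduced_words (a + b) (inflation12 a b \<alpha> \<beta>)"
    using x y word_perm_append_shift[OF s] perm_length_inflation12[OF assms(1,2)]
    unfolding reduced_words_def by auto
qed

text \<open>The letter \<open>a\<close> would create an inversion across the cut, and an inflation
  has none.\<close>

lemma not_in_reduced_word_inflation12: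
  assumes "\<alpha> permutes {1..a}" "\<beta> permutes {1..b}"
    and "w \<in> reduced_words (a + b) (inflation12 a b \<alpha> \<beta>)"
  shows "a \<notin> set w"
proof
  assume "a \<in> set w"
  then obtain i j where "i \<le> a" "a < j" "(i, j) \<in> inversions (a + b) (inflation12 a b \<alpha> \<beta>)"
    using reduced_word_crossing_inversion[OF assms(3)] by blast
  then show False using permutes_in_image[OF assms(1), of i]
    by (auto simp: inversions_def inflation12_def)
qed

text \<open>Sorting \<open>w\<close> by commutations yields a reduced word of the same permutation
  with the two parts separated. \<open>inflation12_inject\<close> then identifies the permutation of
  each part.\<close>

lemma parts_reduced_words:
  assumes \<alpha>: "\<alpha> permutes {1..a}" and \<beta>: "\<beta> permutes {1..b}"
    and w: "w \<in> reduced_words (a + b) (inflation12 a b \<alpha> \<beta>)"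
  shows "lower_part a w \<in> reduced_words a \<alpha>" and "upper_part a w \<in> reduced_words b \<beta>"
proof -
  let ?L = "lower_part a w" and ?U = "upper_part a w"
  have a: "a \<notin> set w" using \<alpha> \<beta> w by (rule not_in_reduced_word_inflation12)
  have letters: "1 \<le> r" "r < a + b" "r \<noteq> a" if "r \<in> set w" for r
  proof -
    have "r \<in> {1..a + b - 1}" "r \<noteq> a" using w that a by (auto simp: reduced_words_def)
    then show "1 \<le> r" "r < a + b" "r \<noteq> a" by auto
  qed
  have L: "set ?L \<subseteq> {1..a - 1}"
  proof
    fix r assume "r \<in> set ?L"
    then have "r \<in> set w" "r \<le> a" by (auto simp: lower_part_def)
    then show "r \<in> {1..a - 1}" using letters[of r] by auto
  qed
  have U: "set ?U \<subseteq> {1..b - 1}"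
  proof
    fix r assume "r \<in> set ?U"
    then obtain r' where "r' \<in> set w" "a < r'" "r = r' - a" by (auto simp: upper_part_def)
    then show "r \<in> {1..b - 1}" using letters[of r'] by auto
  qed
  note perms = word_perm_permutes[OF L] word_perm_permutes[OF U]
  have "wpath (move_cost 0 0) w (0 * crossings (\<lambda>r. a < r) w)
      (filter (\<lambda>r. \<not> a < r) w @ filter (\<lambda>r. a < r) w)"
  proof (rule wpath_sort)
    fix x y assume "x \<in> set w" "y \<in> set w" "a < x" "\<not> a < y"
    then show "\<bar>int x - int y\<bar> > 1" using letters(3)[of y] by linarith
  qed
  then have "wpath (move_cost 0 0) w 0 (?L @ shift a ?U)"
    by (simp add: shift_upper_part lower_part_def)
  \<comment> \<open>Only membership is wanted, so the costs are 0 and the target relation is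
    trivial.\<close>
  from wpath_restrict[OF this w, of "\<lambda>_ _ _. True"] move_cost_reduced_words
  have "?L @ shift a ?U \<in> reduced_words (a + b) (inflation12 a b \<alpha> \<beta>)" by blast
  then have "inflation12 a b (word_perm ?L) (word_perm ?U) = inflation12 a b \<alpha> \<beta>"
    and len: "length ?L + length ?U = perm_length a \<alpha> + perm_length b \<beta>"
    using word_perm_append_shift(1)[OF L U] perm_length_inflation12[OF \<alpha> \<beta>]
    by (simp_all add: reduced_words_def)
  from inflation12_inject[OF perms(1) \<alpha> perms(2) \<beta> this(1)]
  have eq: "word_perm ?L = \<alpha>" "word_perm ?U = \<beta>" .
  \<comment> \<open>Neither part is shorter than the length of its permutation, and the totals
    agree, so both bounds are equalities.\<close>
  moreover have "length ?L = perm_length a \<alpha>" "length ?U = perm_length b \<beta>"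
    using perm_length_word_perm_le[OF L] perm_length_word_perm_le[OF U] len unfolding eq by auto
  ultimately show "?L \<in> reduced_words a \<alpha>" "?U \<in> reduced_words b \<beta>"
    using L U by (auto simp: reduced_words_def)
qed

section \<open>The weighted diameter of an inflation\<close>

lemma wdiam_inflation12:
  assumes \<alpha>: "\<alpha> permutes {1..a}" and \<beta>: "\<beta> permutes {1..b}"
  shows "wdiam (move_cost c d) (reduced_words (a + b) (inflation12 a b \<alpha> \<beta>)) =
     wdiam (move_cost c d) (reduced_words a \<alpha>) + wdiam (move_cost c d) (reduced_words b \<beta>) +
     enat (c * (perm_length a \<alpha> * perm_length b \<beta>))"
    (is "wdiam ?W ?R = wdiam ?W ?A + wdiam ?W ?B + enat ?N")
proof (rule antisym)
  have len: "length x = perm_length a \<alpha>" "length y = perm_length b \<beta>" if "x \<in> ?A" "y \<in> ?B" for x y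
    using that by (auto simp: reduced_words_def)
  have "wdist ?W u v \<le> wdiam ?W ?A + wdiam ?W ?B + enat ?N" if "u \<in> ?R" "v \<in> ?R" for u v
  proof -
    note u = parts_reduced_words[OF \<alpha> \<beta> that(1)] and v = parts_reduced_words[OF \<alpha> \<beta> that(2)]
    have "wdist ?W u v \<le> wdist ?W (lower_part a u) (lower_part a v) +
        wdist ?W (upper_part a u) (upper_part a v) + enat ?N"
      using wdist_shuffle_le[of a u v c d] len[OF u] len[OF v]
        not_in_reduced_word_inflation12[OF \<alpha> \<beta>] that by simp
    also have "\<dots> \<le> wdiam ?W ?A + wdiam ?W ?B + enat ?N"
      using u v by (intro add_mono wdist_le_wdiam order_refl)
    finally show ?thesis .
  qed
  then show "wdiam ?W ?R \<le> wdiam ?W ?A + wdiam ?W ?B + enat ?N"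
    unfolding wdiam_def[of ?W ?R] by (intro SUP_least) auto
  have ne: "?A \<times> ?A \<noteq> {}" "?B \<times> ?B \<noteq> {}"
    using reduced_words_nonempty[OF \<alpha>] reduced_words_nonempty[OF \<beta>] by auto
  have "wdist ?W x x' + wdist ?W y y' + enat ?N \<le> wdiam ?W ?R"
    if "x \<in> ?A" "x' \<in> ?A" "y \<in> ?B" "y' \<in> ?B" for x x' y y'
  proof -
    have "set z \<subseteq> {..<a}" if "z \<in> ?A" for z using that by (fastforce simp: reduced_words_def)
    moreover have "0 \<notin> set z" if "z \<in> ?B" for z using that by (auto simp: reduced_words_def)
    ultimately have "wdist ?W x x' + wdist ?W y y' + enat ?N
        \<le> wdist ?W (x @ shift a y) (shift a y' @ x')"
      using wdist_shuffle_ge[of x a x' y y' c d] that len[of x' y'] by simp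
    also have "\<dots> \<le> wdiam ?W ?R"
      using that by (intro wdist_le_wdiam shuffle_reduced_words[OF \<alpha> \<beta>])
    finally show ?thesis .
  qed
  \<comment> \<open>The two suprema are taken one at a time, with the remaining terms as the
    constant of \<open>enat_SUP_add_le\<close>.\<close>
  then have "(case q of (y, y') \<Rightarrow> wdist ?W y y') + ((case p of (x, x') \<Rightarrow> wdist ?W x x') + enat ?N)
      \<le> wdiam ?W ?R" if "p \<in> ?A \<times> ?A" "q \<in> ?B \<times> ?B" for p q
    using that by (auto simp: ac_simps)
  then have "wdiam ?W ?B + ((case p of (x, x') \<Rightarrow> wdist ?W x x') + enat ?N) \<le> wdiam ?W ?R"
    if "p \<in> ?A \<times> ?A" for p
    unfolding wdiam_def[of ?W ?B] using that by (intro enat_SUP_add_le ne)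
  then have "(case p of (x, x') \<Rightarrow> wdist ?W x x') + (wdiam ?W ?B + enat ?N) \<le> wdiam ?W ?R"
    if "p \<in> ?A \<times> ?A" for p
    using that by (metis add.left_commute)
  then have "wdiam ?W ?A + (wdiam ?W ?B + enat ?N) \<le> wdiam ?W ?R"
    unfolding wdiam_def[of ?W ?A] by (intro enat_SUP_add_le ne)
  then show "wdiam ?W ?A + wdiam ?W ?B + enat ?N \<le> wdiam ?W ?R"
    by (simp add: add.assoc)
qed

theorem theorem3p6:
  fixes a b :: nat and \<alpha> \<beta> \<pi> :: "nat \<Rightarrow> nat"
  assumes "\<alpha> permutes {1..a}"
    and "\<beta> permutes {1..b}"
    and "\<pi> = inflation12 a b \<alpha> \<beta>"
  shows "diam (G_graph (a + b) \<pi>) =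
             diam (G_graph a \<alpha>) + diam (G_graph b \<beta>) + enat (perm_length a \<alpha> * perm_length b \<beta>) \<and>
         diam (C_graph (a + b) \<pi>) = diam (C_graph a \<alpha>) + diam (C_graph b \<beta>) \<and>
         diam (B_graph (a + b) \<pi>) =
             diam (B_graph a \<alpha>) + diam (B_graph b \<beta>) + enat (perm_length a \<alpha> * perm_length b \<beta>)"
  unfolding assms(3) diam_G_graph diam_C_graph diam_B_graph wdiam_inflation12[OF assms(1,2)]
  \<comment> \<open>For commutation classes \<open>c = 0\<close>, so the product term is
    \<open>enat 0\<close>.\<close>
  by (simp add: zero_enat_def[symmetric])

end
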